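(* Let $(p_t)_{t>0}$ be a Markov transition function on a measurable space $(E,\mathcal{B})$ and let $\mathcal{R}$ be the associated class of functions on $E$. Suppose that $\mathcal{E}=\{e_1,\ldots,e_d\}$ and $\mathcal{E}'=\{e'_1,\ldots,e'_{d'}\}$ are finite collections of real-valued (not necessarily bounded) functions on $E$ with $\mathcal{E}\sim\mathcal{R}$ and $\mathcal{E}'\sim\mathcal{R}$, and let $\psi=(e_1,\ldots,e_d):E\to\mathbb{R}^d$ and $\psi'=(e'_1,\ldots,e'_{d'}):E\to\mathbb{R}^{d'}$ be the corresponding maps. Then there exists a continuous bijection between $\overline{\psi(E)}\subset\mathbb{R}^d$ and $\overline{\psi'(E)}\subset\mathbb{R}^{d'}$ whose inverse is also continuous.
   Context: A stochastic kernel on $(E,\mathcal{B})$ is a function $k:E\times\mathcal{B}\to\mathbb{R}$ that is $\mathcal{B}$-measurable in the first variable and a probability measure in the second. A Markov transition function is a family $(p_t)_{t>0}$ of stochastic kernels such that $(t,x)\mapsto p_t(x,B)$ is $\mathcal{B}(\mathbb{R}^+)\times\mathcal{B}$-measurable for each $B\in\mathcal{B}$ and $p_{s+t}(x,B)=\int p_s(x,dy)p_t(y,B)$. Its resolvent is $u^\alpha=\int_0^\infty e^{-\alpha t}p_t\,dt$, $\alpha>0$, acting on bounded measurable functions by $U^\alpha f(x)=\int u^\alpha(x,dy)f(y)$. Let $\mathcal{B}^+$ denote the bounded nonnegative $\mathcal{B}$-measurable functions on $E$ and $\mathcal{C}^+=\bigcup_{\alpha>0}U^\alpha\mathcal{B}^+$.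 $\mathcal{R}_+$ is the unique minimal convex cone with $\mathcal{C}^+\subset\mathcal{R}_+\subset\mathcal{B}^+$, $U^\alpha\mathcal{R}_+\subset\mathcal{R}_+$ for all $\alpha>0$, and $f\wedge g\in\mathcal{R}_+$ whenever $f,g\in\mathcal{R}_+$; and $\mathcal{R}=\mathcal{R}_+-\mathcal{R}_+$. Two classes $\mathcal{H},\mathcal{G}$ of real-valued functions on $E$ generate the same uniformity, written $\mathcal{H}\sim\mathcal{G}$, if for every sequence $(x_n)$ in $E$: $h(x_n)$ is a Cauchy sequence for every $h\in\mathcal{H}$ if and only if $g(x_n)$ is a Cauchy sequence for every $g\in\mathcal{G}$. The bar denotes closure in Euclidean space. *)

theory Defs
  imports "HOL-Probability.Probability"
begin

text \<open>
  A measure \<open>M\<close> stands for the measurable space \<open>(E, \<B>) = (space M, sets M)\<close>; its values as a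
  measure play no role.

  \<open>K \<in> M \<rightarrow>\<^sub>M prob_algebra M\<close> says that \<open>K\<close> is a stochastic kernel: each \<open>K x\<close> with \<open>x \<in> space M\<close> is
  a probability measure on \<open>sets M\<close>, and \<open>K x B\<close> is measurable in \<open>x\<close> for each \<open>B\<close>.
\<close>

definition markov_transition_function :: "'a measure \<Rightarrow> (real \<Rightarrow> 'a \<Rightarrow> 'a measure) \<Rightarrow> bool" where
  "markov_transition_function M p \<longleftrightarrow>
     (\<forall>t>0. p t \<in> M \<rightarrow>\<^sub>M prob_algebra M) \<and>
     (\<forall>B\<in>sets M. (\<lambda>(t, x). measure (p t x) B)
        \<in> borel_measurable (restrict_space borel {0<..} \<Otimes>\<^sub>M M)) \<and>
     (\<forall>s>0. \<forall>t>0. \<forall>x\<in>space M. \<forall>B\<in>sets M.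
        measure (p (s + t) x) B = (\<integral>y. measure (p t y) B \<partial>p s x))"

definition resolvent_kernel ::
    "'a measure \<Rightarrow> (real \<Rightarrow> 'a \<Rightarrow> 'a measure) \<Rightarrow> real \<Rightarrow> 'a \<Rightarrow> 'a measure" where
  "resolvent_kernel M p \<alpha> x = measure_of (space M) (sets M)
     (\<lambda>B. \<integral>\<^sup>+t\<in>{0<..}. ennreal (exp (- \<alpha> * t)) * emeasure (p t x) B \<partial>lborel)"

text \<open>
  A function on \<open>E\<close> belonging to one of the classes below is represented by its extension by \<open>0\<close>
  outside \<open>space M\<close>, so that equality of representatives is equality on \<open>E\<close>, and the pointwise
  operations on representatives are those on \<open>E\<close>.
\<close>

definition resolvent ::
    "'a measure \<Rightarrow> (real \<Rightarrow> 'a \<Rightarrow> 'a measure) \<Rightarrow> real \<Rightarrow> ('a \<Rightarrow> real) \<Rightarrow> 'a \<Rightarrow> real" where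
  "resolvent M p \<alpha> f x =
     (if x \<in> space M then \<integral>y. f y \<partial>resolvent_kernel M p \<alpha> x else 0)"

definition B_plus :: "'a measure \<Rightarrow> ('a \<Rightarrow> real) set" where
  "B_plus M = {f \<in> borel_measurable M.
     (\<forall>x\<in>space M. 0 \<le> f x) \<and> bounded (f ` space M) \<and> (\<forall>x. x \<notin> space M \<longrightarrow> f x = 0)}"

definition C_plus :: "'a measure \<Rightarrow> (real \<Rightarrow> 'a \<Rightarrow> 'a measure) \<Rightarrow> ('a \<Rightarrow> real) set" where
  "C_plus M p = (\<Union>\<alpha>\<in>{0<..}. resolvent M p \<alpha> ` B_plus M)"

definition admissible_cone ::
    "'a measure \<Rightarrow> (real \<Rightarrow> 'a \<Rightarrow> 'a measure) \<Rightarrow> ('a \<Rightarrow> real) set \<Rightarrow> bool" where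
  "admissible_cone M p F \<longleftrightarrow>
     (\<forall>f\<in>F. \<forall>g\<in>F. (\<lambda>x. f x + g x) \<in> F) \<and>
     (\<forall>c\<ge>0. \<forall>f\<in>F. (\<lambda>x. c * f x) \<in> F) \<and>
     C_plus M p \<subseteq> F \<and> F \<subseteq> B_plus M \<and>
     (\<forall>\<alpha>>0. resolvent M p \<alpha> ` F \<subseteq> F) \<and>
     (\<forall>f\<in>F. \<forall>g\<in>F. (\<lambda>x. min (f x) (g x)) \<in> F)"

text \<open>
  The lemma \<open>R_plus_least\<close> below shows that, for a Markov transition function, this intersection is
  itself an admissible cone, and hence the unique minimal one.
\<close>

definition R_plus :: "'a measure \<Rightarrow> (real \<Rightarrow> 'a \<Rightarrow> 'a measure) \<Rightarrow> ('a \<Rightarrow> real) set" where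
  "R_plus M p = \<Inter>{F. admissible_cone M p F}"

definition R_class :: "'a measure \<Rightarrow> (real \<Rightarrow> 'a \<Rightarrow> 'a measure) \<Rightarrow> ('a \<Rightarrow> real) set" where
  "R_class M p = {\<lambda>x. f x - g x |f g. f \<in> R_plus M p \<and> g \<in> R_plus M p}"

definition same_uniformity :: "'a set \<Rightarrow> ('a \<Rightarrow> real) set \<Rightarrow> ('a \<Rightarrow> real) set \<Rightarrow> bool" where
  "same_uniformity E H G \<longleftrightarrow>
     (\<forall>x. (\<forall>n::nat. x n \<in> E) \<longrightarrow>
        ((\<forall>h\<in>H. Cauchy (\<lambda>n. h (x n))) \<longleftrightarrow> (\<forall>g\<in>G. Cauchy (\<lambda>n. g (x n)))))"

context
  fixes M :: "'a measure" and p :: "real \<Rightarrow> 'a \<Rightarrow> 'a measure"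
  assumes markov: "markov_transition_function M p"
begin

lemma markov_kernel:
  assumes "t > 0" "x \<in> space M"
  shows "prob_space (p t x)" "sets (p t x) = sets M" "space (p t x) = space M"
proof -
  have "p t x \<in> space (prob_algebra M)"
    using markov assms by (auto simp: markov_transition_function_def intro: measurable_space)
  then show "prob_space (p t x)" "sets (p t x) = sets M"
    by (auto simp: space_prob_algebra)
  then show "space (p t x) = space M"
    by (metis sets_eq_imp_space_eq)
qed

lemma markov_joint:
  "(\<lambda>(t, x). p t x) \<in> (restrict_space (borel :: real measure) {0<..} \<Otimes>\<^sub>M M) \<rightarrow>\<^sub>M subprob_algebra M"
proof (rule measurable_subprob_algebra)
  fix a assume "a \<in> space (restrict_space (borel :: real measure) {0<..} \<Otimes>\<^sub>M M)"
  then have a: "fst a > (0::real)" "snd a \<in> space M"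
    by (auto simp: space_pair_measure space_restrict_space)
  show "subprob_space (case a of (t, x) \<Rightarrow> p t x)"
    using markov_kernel(1)[OF a] by (simp add: case_prod_beta prob_space_imp_subprob_space)
  show "sets (case a of (t, x) \<Rightarrow> p t x) = sets M"
    using markov_kernel(2)[OF a] by (simp add: case_prod_beta)
next
  fix B assume B: "B \<in> sets M"
  have "(\<lambda>(t, x). ennreal (measure (p t x) B))
      \<in> borel_measurable (restrict_space (borel :: real measure) {0<..} \<Otimes>\<^sub>M M)"
    using markov B by (auto simp: markov_transition_function_def case_prod_beta)
  moreover have "emeasure (case a of (t, x) \<Rightarrow> p t x) B
       = (case a of (t, x) \<Rightarrow> ennreal (measure (p t x) B))"
    if "a \<in> space (restrict_space (borel :: real measure) {0<..} \<Otimes>\<^sub>M M)" for a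
  proof -
    from that have a: "fst a > (0::real)" "snd a \<in> space M"
      by (auto simp: space_pair_measure space_restrict_space)
    interpret prob_space "p (fst a) (snd a)" by (rule markov_kernel[OF a])
    show ?thesis by (simp add: case_prod_beta emeasure_eq_measure)
  qed
  ultimately show "(\<lambda>a. emeasure (case a of (t, x) \<Rightarrow> p t x) B)
      \<in> borel_measurable (restrict_space (borel :: real measure) {0<..} \<Otimes>\<^sub>M M)"
    by (subst measurable_cong) auto
qed

private definition time :: "real \<Rightarrow> real measure" where
  "time \<alpha> = density (restrict_space lborel {0<..}) (\<lambda>t. ennreal (exp (- \<alpha> * t)))"

private lemma sets_time: "sets (time \<alpha>) = sets (restrict_space borel {0<..})"
  unfolding time_def by (simp add: sets_restrict_space)

private lemma space_time: "space (time \<alpha>) = {0<..}"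
  unfolding time_def by (simp add: space_restrict_space)

private lemma nn_integral_time:
  assumes "f \<in> borel_measurable (restrict_space borel {0<..})"
  shows "(\<integral>\<^sup>+t. f t \<partial>time \<alpha>) = (\<integral>\<^sup>+t\<in>{0<..}. ennreal (exp (- \<alpha> * t)) * f t \<partial>lborel)"
proof -
  have *: "f \<in> borel_measurable (restrict_space lborel {0<..})"
    using assms by (simp add: measurable_def sets_restrict_space space_restrict_space)
  show ?thesis
    unfolding time_def
    by (subst nn_integral_density)
       (auto simp: nn_integral_restrict_space intro!: * measurable_restrict_space1)
qed

private lemma joint_time:
  "(\<lambda>(t, x). p t x) \<in> (time \<alpha> \<Otimes>\<^sub>M M) \<rightarrow>\<^sub>M subprob_algebra M"
  using markov_joint measurable_cong_sets[OF sets_pair_measure_cong[OF sets_time[of \<alpha>] refl] refl]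
  by blast

private lemma section_time:
  assumes "x \<in> space M"
  shows "(\<lambda>t. p t x) \<in> time \<alpha> \<rightarrow>\<^sub>M subprob_algebra M"
  using measurable_compose[OF measurable_Pair2'[OF assms] joint_time] by simp

private lemma
  assumes x: "x \<in> space M"
  shows sets_time_bind: "sets (time \<alpha> \<bind> (\<lambda>t. p t x)) = sets M"
    and emeasure_time_bind: "B \<in> sets M \<Longrightarrow> emeasure (time \<alpha> \<bind> (\<lambda>t. p t x)) B
      = (\<integral>\<^sup>+t\<in>{0<..}. ennreal (exp (- \<alpha> * t)) * emeasure (p t x) B \<partial>lborel)"
proof -
  have ne: "space (time \<alpha>) \<noteq> {}" by (simp add: space_time)
  show "sets (time \<alpha> \<bind> (\<lambda>t. p t x)) = sets M"
    by (rule sets_bind) (auto simp: space_time markov_kernel x)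
  assume B: "B \<in> sets M"
  have "(\<lambda>t. emeasure (p t x) B) \<in> borel_measurable (time \<alpha>)"
    using section_time[OF x] B by (rule measurable_emeasure_kernel)
  then have "(\<lambda>t. emeasure (p t x) B) \<in> borel_measurable (restrict_space borel {0<..})"
    using measurable_cong_sets[OF sets_time refl] by blast
  then show "emeasure (time \<alpha> \<bind> (\<lambda>t. p t x)) B
      = (\<integral>\<^sup>+t\<in>{0<..}. ennreal (exp (- \<alpha> * t)) * emeasure (p t x) B \<partial>lborel)"
    by (subst emeasure_bind[OF ne section_time[OF x] B]) (rule nn_integral_time)
qed

private lemma resolvent_kernel_eq_bind:
  assumes x: "x \<in> space M"
  shows "resolvent_kernel M p \<alpha> x = time \<alpha> \<bind> (\<lambda>t. p t x)"
proof -
  have "resolvent_kernel M p \<alpha> x = measure_of (space M) (sets M) (emeasure (time \<alpha> \<bind> (\<lambda>t. p t x)))"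
    unfolding resolvent_kernel_def
    by (rule measure_of_eq)
       (auto simp: emeasure_time_bind[OF x] sets.space_closed sets.sigma_sets_eq)
  also have "\<dots> = time \<alpha> \<bind> (\<lambda>t. p t x)"
    using measure_of_of_measure[of "time \<alpha> \<bind> (\<lambda>t. p t x)"] sets_time_bind[OF x]
      sets_eq_imp_space_eq[OF sets_time_bind[OF x]] by simp
  finally show ?thesis .
qed

lemma emeasure_resolvent_kernel:
  assumes "x \<in> space M" "B \<in> sets M"
  shows "emeasure (resolvent_kernel M p \<alpha> x) B
      = (\<integral>\<^sup>+t\<in>{0<..}. ennreal (exp (- \<alpha> * t)) * emeasure (p t x) B \<partial>lborel)"
  using assms by (simp add: resolvent_kernel_eq_bind emeasure_time_bind)

lemma sets_resolvent_kernel: "sets (resolvent_kernel M p \<alpha> x) = sets M"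
  unfolding resolvent_kernel_def by (simp add: sets.space_closed sets.sigma_sets_eq)

private lemma nn_integral_resolvent_kernel:
  assumes "x \<in> space M" "f \<in> borel_measurable M"
  shows "(\<integral>\<^sup>+y. f y \<partial>resolvent_kernel M p \<alpha> x) = (\<integral>\<^sup>+t. (\<integral>\<^sup>+y. f y \<partial>p t x) \<partial>time \<alpha>)"
  using assms by (simp add: resolvent_kernel_eq_bind nn_integral_bind[OF _ section_time])

private lemma emeasure_time:
  assumes "\<alpha> > 0"
  shows "emeasure (time \<alpha>) (space (time \<alpha>)) = ennreal (1 / \<alpha>)"
proof -
  have "emeasure (time \<alpha>) (space (time \<alpha>)) = (\<integral>\<^sup>+t. 1 \<partial>time \<alpha>)" by simp
  also have "\<dots> = (\<integral>\<^sup>+t\<in>{0<..}. ennreal (exp (- \<alpha> * t)) * 1 \<partial>lborel)"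
    by (rule nn_integral_time) simp
  also have "\<dots> = (\<integral>\<^sup>+t. ennreal (exp (- \<alpha> * t)) * indicator {0..} t \<partial>lborel)"
  proof (rule nn_integral_cong_AE)
    have "AE t in lborel. t \<noteq> (0::real)" by (rule AE_lborel_singleton)
    then show "AE t in lborel. ennreal (exp (- \<alpha> * t)) * 1 * indicator {0<..} t
        = ennreal (exp (- \<alpha> * t)) * indicator {0..} t"
      by eventually_elim (auto simp: indicator_def)
  qed
  also have "\<dots> = ennreal (0 - (- exp (- \<alpha> * 0) / \<alpha>))"
  proof (rule nn_integral_FTC_atLeast)
    show "((\<lambda>t. - exp (- \<alpha> * t) / \<alpha>) has_real_derivative exp (- \<alpha> * t)) (at t)" for t
      using assms by (auto intro!: derivative_eq_intros)
    show "((\<lambda>t. - exp (- \<alpha> * t) / \<alpha>) \<longlongrightarrow> 0) at_top"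
      using assms by real_asymp
  qed auto
  finally show ?thesis using assms by simp
qed

lemma emeasure_resolvent_kernel_space:
  assumes "\<alpha> > 0" "x \<in> space M"
  shows "emeasure (resolvent_kernel M p \<alpha> x) (space M) = ennreal (1 / \<alpha>)"
proof -
  have "emeasure (resolvent_kernel M p \<alpha> x) (space M) = (\<integral>\<^sup>+y. 1 \<partial>resolvent_kernel M p \<alpha> x)"
    using sets_eq_imp_space_eq[OF sets_resolvent_kernel] by simp
  also have "\<dots> = (\<integral>\<^sup>+t. 1 \<partial>time \<alpha>)"
  proof -
    have "(\<integral>\<^sup>+y. 1 \<partial>p t x) = 1" if "t \<in> space (time \<alpha>)" for t
      using that assms(2) markov_kernel(1)[of t x]
      by (simp add: space_time prob_space.emeasure_space_1)
    then show ?thesis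
      using assms(2) nn_integral_cong[of "time \<alpha>" "\<lambda>t. \<integral>\<^sup>+y. 1 \<partial>p t x" "\<lambda>_. 1"]
      by (subst nn_integral_resolvent_kernel) (auto simp del: nn_integral_const)
  qed
  finally show ?thesis using emeasure_time[OF assms(1)] by simp
qed

lemma resolvent_B_plus:
  assumes \<alpha>: "\<alpha> > 0" and f: "f \<in> B_plus M"
  shows "resolvent M p \<alpha> f \<in> B_plus M"
proof -
  have meas: "f \<in> borel_measurable M" and bd: "bounded (f ` space M)"
    using f by (auto simp: B_plus_def)
  have nn: "0 \<le> f x" for x
    using f by (cases "x \<in> space M") (auto simp: B_plus_def)
  from bd obtain K where K: "\<And>x. x \<in> space M \<Longrightarrow> f x \<le> K" "K \<ge> 0"
    by (auto simp: bounded_pos nn intro: less_imp_le)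
  have eq: "resolvent M p \<alpha> f x = enn2real (\<integral>\<^sup>+t. (\<integral>\<^sup>+y. ennreal (f y) \<partial>p t x) \<partial>time \<alpha>)"
    if x: "x \<in> space M" for x
  proof -
    have "f \<in> borel_measurable (resolvent_kernel M p \<alpha> x)"
      using meas measurable_cong_sets[OF sets_resolvent_kernel refl] by blast
    then have "(\<integral>y. f y \<partial>resolvent_kernel M p \<alpha> x)
        = enn2real (\<integral>\<^sup>+y. ennreal (f y) \<partial>resolvent_kernel M p \<alpha> x)"
      by (intro integral_eq_nn_integral) (auto simp: nn)
    then show ?thesis
      using x meas by (simp add: resolvent_def nn_integral_resolvent_kernel)
  qed
  have bnd: "resolvent M p \<alpha> f x \<le> K * (1 / \<alpha>)" if x: "x \<in> space M" for x
  proof -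
    have "(\<integral>\<^sup>+t. (\<integral>\<^sup>+y. ennreal (f y) \<partial>p t x) \<partial>time \<alpha>) \<le> (\<integral>\<^sup>+t. ennreal K \<partial>time \<alpha>)"
    proof (rule nn_integral_mono)
      fix t assume "t \<in> space (time \<alpha>)"
      then have t: "t > 0" by (simp add: space_time)
      have "(\<integral>\<^sup>+y. ennreal (f y) \<partial>p t x) \<le> (\<integral>\<^sup>+y. ennreal K \<partial>p t x)"
        by (rule nn_integral_mono) (auto simp: markov_kernel[OF t x] intro!: ennreal_leI K)
      also have "\<dots> = ennreal K"
        using prob_space.emeasure_space_1[OF markov_kernel(1)[OF t x]] by simp
      finally show "(\<integral>\<^sup>+y. ennreal (f y) \<partial>p t x) \<le> ennreal K" .
    qed
    also have "\<dots> = ennreal (K * (1 / \<alpha>))"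
      using emeasure_time[OF \<alpha>] \<alpha> K(2) by (simp add: ennreal_mult'[symmetric])
    finally show ?thesis
      using \<alpha> K(2) by (simp add: eq[OF x] enn2real_leI)
  qed
  have fin: "sigma_finite_measure (time \<alpha>)"
    by (intro finite_measure.sigma_finite_measure finite_measureI) (simp add: emeasure_time[OF \<alpha>])
  have "(\<lambda>a. \<integral>\<^sup>+y. ennreal (f y) \<partial>(case a of (t, x) \<Rightarrow> p t x)) \<in> borel_measurable (time \<alpha> \<Otimes>\<^sub>M M)"
    by (rule measurable_compose[OF joint_time nn_integral_measurable_subprob_algebra])
       (use meas in simp)
  then have "(\<lambda>(x, t). \<integral>\<^sup>+y. ennreal (f y) \<partial>p t x) \<in> borel_measurable (M \<Otimes>\<^sub>M time \<alpha>)"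
    by (rule measurable_compose[OF measurable_pair_swap', THEN measurable_cong[THEN iffD1, rotated]])
       (simp add: case_prod_beta)
  then have "(\<lambda>x. \<integral>\<^sup>+t. (\<integral>\<^sup>+y. ennreal (f y) \<partial>p t x) \<partial>time \<alpha>) \<in> borel_measurable M"
    by (rule sigma_finite_measure.borel_measurable_nn_integral[OF fin])
  then have "(\<lambda>x. enn2real (\<integral>\<^sup>+t. (\<integral>\<^sup>+y. ennreal (f y) \<partial>p t x) \<partial>time \<alpha>)) \<in> borel_measurable M"
    by simp
  then have "resolvent M p \<alpha> f \<in> borel_measurable M"
    by (subst measurable_cong[OF eq])
  moreover have "0 \<le> resolvent M p \<alpha> f x" for x
    by (simp add: resolvent_def nn)
  moreover have "bounded (resolvent M p \<alpha> f ` space M)"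
    using bnd calculation(2) by (auto simp: bounded_iff intro!: exI[of _ "K * (1 / \<alpha>)"])
  ultimately show ?thesis by (simp add: B_plus_def) (simp add: resolvent_def)
qed

lemma admissible_cone_B_plus: "admissible_cone M p (B_plus M)"
proof -
  have "(\<lambda>x. f x + g x) \<in> B_plus M" if "f \<in> B_plus M" "g \<in> B_plus M" for f g
    using that bounded_plus_comp[of f "space M" g] by (auto simp: B_plus_def)
  moreover have "(\<lambda>x. c * f x) \<in> B_plus M" if "c \<ge> 0" "f \<in> B_plus M" for c f
    using that bounded_scaling[of "f ` space M" c] by (auto simp: B_plus_def image_image)
  moreover have "(\<lambda>x. min (f x) (g x)) \<in> B_plus M" if "f \<in> B_plus M" "g \<in> B_plus M" for f g
  proof -
    from that(1) have "bounded (f ` space M)" by (simp add: B_plus_def)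
    then obtain K where K: "\<forall>y\<in>f ` space M. norm y \<le> K"
      unfolding bounded_iff by blast
    have "norm (min (f x) (g x)) \<le> K" if x: "x \<in> space M" for x
    proof -
      have "0 \<le> f x" "0 \<le> g x"
        using \<open>f \<in> B_plus M\<close> \<open>g \<in> B_plus M\<close> x by (simp_all add: B_plus_def)
      moreover have "norm (f x) \<le> K" using K x by simp
      ultimately show ?thesis by simp
    qed
    then have "bounded ((\<lambda>x. min (f x) (g x)) ` space M)"
      unfolding bounded_iff by blast
    then show ?thesis using that by (auto simp: B_plus_def)
  qed
  ultimately show ?thesis
    by (auto simp: admissible_cone_def C_plus_def resolvent_B_plus)
qed

lemma R_plus_least:
  "admissible_cone M p (R_plus M p)"
  "admissible_cone M p F \<Longrightarrow> R_plus M p \<subseteq> F"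
proof -
  show "admissible_cone M p F \<Longrightarrow> R_plus M p \<subseteq> F"
    by (auto simp: R_plus_def)
  have mem: "f \<in> R_plus M p \<longleftrightarrow> (\<forall>F. admissible_cone M p F \<longrightarrow> f \<in> F)" for f
    by (auto simp: R_plus_def)
  show "admissible_cone M p (R_plus M p)"
    unfolding admissible_cone_def[of M p "R_plus M p"]
  proof (intro conjI ballI allI impI subsetI)
    show "f \<in> B_plus M" if "f \<in> R_plus M p" for f
      using that admissible_cone_B_plus by (simp add: mem)
    show "(\<lambda>x. f x + g x) \<in> R_plus M p" if "f \<in> R_plus M p" "g \<in> R_plus M p" for f g
      unfolding mem
    proof (intro allI impI)
      fix F assume F: "admissible_cone M p F"
      with that have "f \<in> F" "g \<in> F" by (simp_all add: mem)
      from F have "\<forall>f\<in>F. \<forall>g\<in>F. (\<lambda>x. f x + g x) \<in> F"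
        by (simp add: admissible_cone_def)
      from this[THEN bspec, OF \<open>f \<in> F\<close>, THEN bspec, OF \<open>g \<in> F\<close>]
      show "(\<lambda>x. f x + g x) \<in> F" .
    qed
    show "(\<lambda>x. min (f x) (g x)) \<in> R_plus M p" if "f \<in> R_plus M p" "g \<in> R_plus M p" for f g
      unfolding mem
    proof (intro allI impI)
      fix F assume F: "admissible_cone M p F"
      with that have "f \<in> F" "g \<in> F" by (simp_all add: mem)
      from F have "\<forall>f\<in>F. \<forall>g\<in>F. (\<lambda>x. min (f x) (g x)) \<in> F"
        by (simp add: admissible_cone_def)
      from this[THEN bspec, OF \<open>f \<in> F\<close>, THEN bspec, OF \<open>g \<in> F\<close>]
      show "(\<lambda>x. min (f x) (g x)) \<in> F" .
    qed
    show "(\<lambda>x. c * f x) \<in> R_plus M p" if "0 \<le> c" "f \<in> R_plus M p" for c f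
      unfolding mem
    proof (intro allI impI)
      fix F assume F: "admissible_cone M p F"
      with that have "f \<in> F" by (simp add: mem)
      from F have "\<forall>c\<ge>0. \<forall>f\<in>F. (\<lambda>x. c * f x) \<in> F"
        by (simp add: admissible_cone_def)
      from this[rule_format, OF that(1) \<open>f \<in> F\<close>] show "(\<lambda>x. c * f x) \<in> F" .
    qed
    show "f \<in> R_plus M p" if "f \<in> C_plus M p" for f
      using that by (auto simp: mem admissible_cone_def)
    show "f \<in> R_plus M p" if "0 < \<alpha>" "f \<in> resolvent M p \<alpha> ` R_plus M p" for \<alpha> f
      unfolding mem
    proof (intro allI impI)
      fix F assume F: "admissible_cone M p F"
      with that(2) have "f \<in> resolvent M p \<alpha> ` F" by (auto simp: mem)
      moreover from F that(1) have "resolvent M p \<alpha> ` F \<subseteq> F"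
        by (simp add: admissible_cone_def)
      ultimately show "f \<in> F" by blast
    qed
  qed
qed

end

end

theory Submission
  imports Defs
begin

text \<open>
  Both collections determine the same Cauchy sequences in \<open>E\<close>, so \<open>\<psi>' \<circ> \<psi>\<inverse>\<close> is well defined on
  \<open>\<psi>(E)\<close> and, like its inverse, maps Cauchy sequences to Cauchy sequences. Since Euclidean spaces
  are complete, both maps extend continuously to the closures, where they remain inverse to each
  other by density.
\<close>

lemma Cauchy_factor_extends_to_closure:
  fixes f :: "'a \<Rightarrow> 'b::metric_space" and g :: "'a \<Rightarrow> 'c::complete_space"
  assumes Cauchy: "\<And>x. \<lbrakk>\<And>n. x n \<in> E; Cauchy (\<lambda>n. f (x n))\<rbrakk> \<Longrightarrow> Cauchy (\<lambda>n. g (x n))"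
  obtains h where "continuous_on (closure (f ` E)) h" "\<And>a. a \<in> E \<Longrightarrow> h (f a) = g a"
proof -
  have eq: "g a = g b" if "a \<in> E" "b \<in> E" "f a = f b" for a b
  proof -
    \<comment> \<open>Alternate between \<open>a\<close> and \<open>b\<close>: \<open>f\<close> sees
      a constant sequence, while \<open>g\<close> sees one that is Cauchy only if
      \<open>g a = g b\<close>.\<close>
    have "(\<lambda>n. f (if even n then a else b)) = (\<lambda>n::nat. f b)"
      using that(3) by auto
    then have "Cauchy (\<lambda>n::nat. g (if even n then a else b))"
      using that by (intro Cauchy) (auto simp: convergent_const intro: convergent_Cauchy)
    then have "Cauchy (\<lambda>n::nat. if even n then g a else g b)"
      by (simp add: if_distrib)
    then have "(\<lambda>n::nat. g a) \<longlonglongrightarrow> g b"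
      using Met_TC.MCauchy_interleaving[of "\<lambda>n. g a" "g b"] by simp
    then show ?thesis by (simp add: LIMSEQ_const_iff)
  qed
  \<comment> \<open>Any choice of preimage serves, since \<open>eq\<close> makes the value of
    \<open>g\<close> independent of it.\<close>
  define k where "k = g \<circ> inv_into E f"
  have k: "k (f a) = g a" if "a \<in> E" for a
    using eq[of "inv_into E f (f a)" a] that
    by (simp add: k_def inv_into_into f_inv_into_f)
  have "Cauchy_continuous_on (f ` E) k"
    unfolding Cauchy_continuous_on_def
  proof (intro allI impI)
    fix \<sigma> :: "nat \<Rightarrow> 'b" assume \<sigma>: "Cauchy \<sigma>" "range \<sigma> \<subseteq> f ` E"
    have "Cauchy (\<lambda>n. g (inv_into E f (\<sigma> n)))"
    proof (rule Cauchy)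
      show "inv_into E f (\<sigma> n) \<in> E" for n
        using \<sigma>(2) by (intro inv_into_into) auto
      have "f (inv_into E f (\<sigma> n)) = \<sigma> n" for n
        using \<sigma>(2) by (intro f_inv_into_f) auto
      then show "Cauchy (\<lambda>n. f (inv_into E f (\<sigma> n)))"
        using \<sigma>(1) by simp
    qed
    then show "Cauchy (k \<circ> \<sigma>)" by (simp add: k_def o_def)
  qed
  then have cc: "Cauchy_continuous_map (submetric euclidean_metric (f ` E)) euclidean_metric k"
    by simp
  have "mcomplete_of (euclidean_metric :: 'c metric)"
    by (simp add: mcomplete_of_def complete_UNIV)
  then obtain h where "continuous_on (closure (f ` E)) h" "\<And>y. y \<in> f ` E \<Longrightarrow> h y = k y"
    using Cauchy_continuous_map_extends_to_continuous_closure_of[OF _ cc] by auto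
  with k that show thesis by auto
qed

text \<open>The equivalence allows the extension in both directions. The two extensions are mutually
  inverse on the images of \<open>E\<close>, which are dense in the closures, hence everywhere
  there.\<close>

lemma homeomorphic_closure_image_if_Cauchy_iff:
  fixes f :: "'a \<Rightarrow> 'b::complete_space" and g :: "'a \<Rightarrow> 'c::complete_space"
  assumes "\<And>x. (\<And>n. x n \<in> E) \<Longrightarrow> Cauchy (\<lambda>n. f (x n)) \<longleftrightarrow> Cauchy (\<lambda>n. g (x n))"
  shows "closure (f ` E) homeomorphic closure (g ` E)"
proof -
  obtain h where h: "continuous_on (closure (f ` E)) h" "\<And>a. a \<in> E \<Longrightarrow> h (f a) = g a"
    using Cauchy_factor_extends_to_closure[of E f g] assms by blast
  obtain k where k: "continuous_on (closure (g ` E)) k" "\<And>a. a \<in> E \<Longrightarrow> k (g a) = f a"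
    using Cauchy_factor_extends_to_closure[of E g f] assms by blast
  have h_in: "h ` closure (f ` E) \<subseteq> closure (g ` E)"
    by (rule image_closure_subset[OF h(1)]) (auto simp: h(2) intro: closure_subset[THEN subsetD])
  have k_in: "k ` closure (g ` E) \<subseteq> closure (f ` E)"
    by (rule image_closure_subset[OF k(1)]) (auto simp: k(2) intro: closure_subset[THEN subsetD])
  have kh: "k (h y) = y" if "y \<in> closure (f ` E)" for y
  proof -
    have "dist (k (h y)) y = 0"
    proof (rule continuous_constant_on_closure[where f = "\<lambda>y. dist (k (h y)) y"])
      show "continuous_on (closure (f ` E)) (\<lambda>y. dist (k (h y)) y)"
        by (intro continuous_on_dist continuous_on_id continuous_on_compose2[OF k(1) h(1) h_in])
    qed (use that h(2) k(2) in auto)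
    then show ?thesis by simp
  qed
  have hk: "h (k y) = y" if "y \<in> closure (g ` E)" for y
  proof -
    have "dist (h (k y)) y = 0"
    proof (rule continuous_constant_on_closure[where f = "\<lambda>y. dist (h (k y)) y"])
      show "continuous_on (closure (g ` E)) (\<lambda>y. dist (h (k y)) y)"
        by (intro continuous_on_dist continuous_on_id continuous_on_compose2[OF h(1) k(1) k_in])
    qed (use that h(2) k(2) in auto)
    then show ?thesis by simp
  qed
  show ?thesis
    unfolding homeomorphic_minimal using h(1) k(1) h_in k_in kh hk by blast
qed

text \<open>Finitely many coordinates control the Euclidean distance. This turns the condition on a
  class of functions in \<open>same_uniformity\<close> into one on a single vector-valued
  map.\<close>

lemma Cauchy_vec_lambda_iff:
  fixes e :: "'d::finite \<Rightarrow> 'a \<Rightarrow> 'b::metric_space"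
  shows "Cauchy (\<lambda>n. \<chi> i. e i (x n)) \<longleftrightarrow> (\<forall>h\<in>range e. Cauchy (\<lambda>n. h (x n)))"
  using Cauchy_vec_nth[of "\<lambda>n. \<chi> i. e i (x n)"] vec_CauchyI[of "\<lambda>n. \<chi> i. e i (x n)"]
  by auto

theorem proposition2p16:
  fixes M :: "'a measure" and p :: "real \<Rightarrow> 'a \<Rightarrow> 'a measure"
    and e :: "'d::finite \<Rightarrow> 'a \<Rightarrow> real" and e' :: "'d'::finite \<Rightarrow> 'a \<Rightarrow> real"
    and \<psi> :: "'a \<Rightarrow> real ^ 'd" and \<psi>' :: "'a \<Rightarrow> real ^ 'd'"
  assumes "markov_transition_function M p"
    and "same_uniformity (space M) (range e) (R_class M p)"
    and "same_uniformity (space M) (range e') (R_class M p)"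
    and "\<psi> = (\<lambda>x. \<chi> i. e i x)"
    and "\<psi>' = (\<lambda>x. \<chi> i. e' i x)"
  shows "closure (\<psi> ` space M) homeomorphic closure (\<psi>' ` space M)"
proof (rule homeomorphic_closure_image_if_Cauchy_iff)
  fix x :: "nat \<Rightarrow> 'a" assume "\<And>n. x n \<in> space M"
  \<comment> \<open>Both sides are equivalent to \<open>h (x n)\<close> being Cauchy for every
    \<open>h\<close> in \<open>R_class M p\<close>.\<close>
  with assms(2,3) show "Cauchy (\<lambda>n. \<psi> (x n)) \<longleftrightarrow> Cauchy (\<lambda>n. \<psi>' (x n))"
    unfolding assms(4,5) Cauchy_vec_lambda_iff same_uniformity_def by metis
qed

end
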